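(* Let $A$ and $B$ be commutative rings with $1\neq0$ and let $f\colon A\to B$ be a ring homomorphism. (1) If $S$ is a strongly multiplicative set of $A$, $0\notin f(S)$, and $1\in f(S)$, then $f(S)$ is a strongly multiplicative set of $B$. (2) If $S$ is a strongly multiplicative set of $A$, $f$ is surjective, and $0\notin f(S)$, then $f(S)$ is a strongly multiplicative set of $B$.
   Context: A multiplicative set $S$ of a commutative ring $R$ is a subset with $0\notin S$, $1\in S$, and $st\in S$ for all $s,t\in S$. It is strongly multiplicative if $\bigl(\bigcap_{i\in\Delta}s_iR\bigr)\cap S\neq\varnothing$ for every family $(s_i)_{i\in\Delta}$ of elements of $S$. *)

theory Defs
  imports "HOL-Algebra.Ideal"
begin

definition multiplicative_set :: "('a, 'm) ring_scheme \<Rightarrow> 'a set \<Rightarrow> bool" where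
  "multiplicative_set R S \<longleftrightarrow>
     S \<subseteq> carrier R \<and> \<zero>\<^bsub>R\<^esub> \<notin> S \<and> \<one>\<^bsub>R\<^esub> \<in> S \<and> (\<forall>s\<in>S. \<forall>t\<in>S. s \<otimes>\<^bsub>R\<^esub> t \<in> S)"

(* A definition cannot quantify over the type of indices. Index sets inside the element type
   of R suffice, since the intersection depends only on the range of the family; the lemma
   strongly_multiplicative_family below gives the condition for arbitrary index types.
   The intersection over an empty index set is UNIV; as it is met with S \<subseteq> carrier R,
   this agrees with the convention that it is R. *)
definition strongly_multiplicative :: "('a, 'm) ring_scheme \<Rightarrow> 'a set \<Rightarrow> bool" where
  "strongly_multiplicative R S \<longleftrightarrow>
     multiplicative_set R S \<and>
     (\<forall>(\<Delta> :: 'a set) (s :: 'a \<Rightarrow> 'a). (\<forall>i\<in>\<Delta>. s i \<in> S) \<longrightarrow>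
        (\<Inter>i\<in>\<Delta>. PIdl\<^bsub>R\<^esub> (s i)) \<inter> S \<noteq> {})"

lemma strongly_multiplicative_family:
  fixes s :: "'i \<Rightarrow> 'a" and \<Delta> :: "'i set"
  assumes "strongly_multiplicative R S" and "\<forall>i\<in>\<Delta>. s i \<in> S"
  shows "(\<Inter>i\<in>\<Delta>. PIdl\<^bsub>R\<^esub> (s i)) \<inter> S \<noteq> {}"
proof -
  have fam: "\<forall>(\<Gamma> :: 'a set) (t :: 'a \<Rightarrow> 'a). (\<forall>x\<in>\<Gamma>. t x \<in> S) \<longrightarrow>
      (\<Inter>x\<in>\<Gamma>. PIdl\<^bsub>R\<^esub> (t x)) \<inter> S \<noteq> {}"
    using assms(1) unfolding strongly_multiplicative_def by (rule conjunct2)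
  have "\<forall>x\<in>s ` \<Delta>. id x \<in> S"
    using assms(2) by simp
  then have "(\<Inter>x\<in>s ` \<Delta>. PIdl\<^bsub>R\<^esub> (id x)) \<inter> S \<noteq> {}"
    by (rule fam[THEN spec[of _ "s ` \<Delta>"], THEN spec[of _ id], THEN mp])
  then show ?thesis by simp
qed

(* Ring homomorphisms that need not preserve 1, unlike the library's ring_hom. Otherwise the
   hypothesis 1 \<in> f(S) would follow from 1 \<in> S. *)
definition nonunital_ring_hom ::
    "('a, 'm) ring_scheme \<Rightarrow> ('b, 'n) ring_scheme \<Rightarrow> ('a \<Rightarrow> 'b) set" where
  "nonunital_ring_hom R S =
     {h. h \<in> carrier R \<rightarrow> carrier S \<and>
         (\<forall>x\<in>carrier R. \<forall>y\<in>carrier R.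
            h (x \<otimes>\<^bsub>R\<^esub> y) = h x \<otimes>\<^bsub>S\<^esub> h y \<and> h (x \<oplus>\<^bsub>R\<^esub> y) = h x \<oplus>\<^bsub>S\<^esub> h y)}"

lemma ring_hom_eq_nonunital:
  "ring_hom R S = {h \<in> nonunital_ring_hom R S. h \<one>\<^bsub>R\<^esub> = \<one>\<^bsub>S\<^esub>}"
  unfolding ring_hom_def nonunital_ring_hom_def by auto

end

theory Submission imports Defs begin

text \<open>A multiplicative map sends multiples to multiples, so \<open>f\<close> carries each
  principal ideal of \<open>A\<close> into the principal ideal generated by the image
  (\<open>nonunital_ring_hom_cgenideal\<close>). Given a family in f(S), lift it to a family in
  \<open>S\<close> and take a common multiple x of the lifts that lies in \<open>S\<close>; then
  f(x) is a common multiple of the given family and lies in f(S). This is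
  \<open>strongly_multiplicative_image\<close>, which covers the first claim. The second reduces to
  it: a surjective \<open>f\<close> must send 1 to 1 (\<open>surj_nonunital_ring_hom_one\<close>),
  so 1 lies in f(S).\<close>

lemma nonunital_ring_hom_closed:
  assumes "f \<in> nonunital_ring_hom A B" and "x \<in> carrier A"
  shows "f x \<in> carrier B"
  using assms unfolding nonunital_ring_hom_def by blast

lemma nonunital_ring_hom_mult:
  assumes "f \<in> nonunital_ring_hom A B" and "x \<in> carrier A" and "y \<in> carrier A"
  shows "f (x \<otimes>\<^bsub>A\<^esub> y) = f x \<otimes>\<^bsub>B\<^esub> f y"
  using assms unfolding nonunital_ring_hom_def by blast

text \<open>This is f(ra) = f(r)f(a). Only the inclusion is claimed: without surjectivity, the image
  of an ideal need not be an ideal of \<open>B\<close>.\<close>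

lemma nonunital_ring_hom_cgenideal:
  assumes "f \<in> nonunital_ring_hom A B" and "a \<in> carrier A" and "x \<in> PIdl\<^bsub>A\<^esub> a"
  shows "f x \<in> PIdl\<^bsub>B\<^esub> (f a)"
proof -
  obtain r where "r \<in> carrier A" "x = r \<otimes>\<^bsub>A\<^esub> a"
    using assms(3) unfolding cgenideal_def by blast
  then show ?thesis
    using assms(1,2) nonunital_ring_hom_closed nonunital_ring_hom_mult
    unfolding cgenideal_def by fastforce
qed

text \<open>f(1) acts as an identity on the image of \<open>f\<close>. When the image is all of
  \<open>B\<close>, it acts so on the unit of \<open>B\<close> too, and hence equals it.\<close>

lemma surj_nonunital_ring_hom_one:
  assumes "cring A" and "cring B" and f: "f \<in> nonunital_ring_hom A B"
    and surj: "f ` carrier A = carrier B"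
  shows "f \<one>\<^bsub>A\<^esub> = \<one>\<^bsub>B\<^esub>"
proof -
  interpret A: cring A by fact
  interpret B: cring B by fact
  have "\<one>\<^bsub>B\<^esub> \<in> f ` carrier A"
    using surj by simp
  then obtain a where a: "a \<in> carrier A" "f a = \<one>\<^bsub>B\<^esub>"
    by force
  \<comment> \<open>The product f(1)f(a) is evaluated twice: it is f(1) because f(a) = 1, and it is
    f(1a) = f(a) = 1 by multiplicativity.\<close>
  have "f \<one>\<^bsub>A\<^esub> = f \<one>\<^bsub>A\<^esub> \<otimes>\<^bsub>B\<^esub> f a"
    using a(2) nonunital_ring_hom_closed[OF f A.one_closed] by simp
  also have "\<dots> = f (\<one>\<^bsub>A\<^esub> \<otimes>\<^bsub>A\<^esub> a)"
    using nonunital_ring_hom_mult[OF f A.one_closed a(1)] by simp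
  also have "\<dots> = \<one>\<^bsub>B\<^esub>"
    using a by simp
  finally show ?thesis .
qed

lemma multiplicative_set_image:
  assumes f: "f \<in> nonunital_ring_hom A B" and S: "multiplicative_set A S"
    and "\<zero>\<^bsub>B\<^esub> \<notin> f ` S" and "\<one>\<^bsub>B\<^esub> \<in> f ` S"
  shows "multiplicative_set B (f ` S)"
proof -
  have carr: "S \<subseteq> carrier A" and mult: "\<And>s t. s \<in> S \<Longrightarrow> t \<in> S \<Longrightarrow> s \<otimes>\<^bsub>A\<^esub> t \<in> S"
    using S unfolding multiplicative_set_def by blast+
  have "f s \<otimes>\<^bsub>B\<^esub> f t \<in> f ` S" if "s \<in> S" "t \<in> S" for s t
    using that carr mult nonunital_ring_hom_mult[OF f, of s t]
    by (metis imageI subsetD)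
  then show ?thesis
    using assms(3,4) carr nonunital_ring_hom_closed[OF f]
    unfolding multiplicative_set_def by blast
qed

text \<open>Stated without surjectivity so that it serves both claims; the unit condition on f(S) is
  what each of them has to supply.\<close>

lemma strongly_multiplicative_image:
  fixes A :: "('a, 'm) ring_scheme" and B :: "('b, 'n) ring_scheme"
  assumes f: "f \<in> nonunital_ring_hom A B" and S: "strongly_multiplicative A S"
    and "\<zero>\<^bsub>B\<^esub> \<notin> f ` S" and "\<one>\<^bsub>B\<^esub> \<in> f ` S"
  shows "strongly_multiplicative B (f ` S)"
  unfolding strongly_multiplicative_def
proof (intro conjI allI impI)
  have multS: "multiplicative_set A S"
    using S unfolding strongly_multiplicative_def by blast
  then have carr: "S \<subseteq> carrier A"
    unfolding multiplicative_set_def by blast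
  show "multiplicative_set B (f ` S)"
    using multiplicative_set_image[OF f multS assms(3,4)] .
  fix \<Delta> :: "'b set" and t :: "'b \<Rightarrow> 'b"
  assume "\<forall>i\<in>\<Delta>. t i \<in> f ` S"
  \<comment> \<open>Choosing preimages gives a family \<open>g\<close> in \<open>S\<close> that is
    still indexed by a subset of \<open>'b\<close>.\<close>
  then have "\<forall>i\<in>\<Delta>. \<exists>s\<in>S. f s = t i"
    by force
  then obtain g where g: "\<forall>i\<in>\<Delta>. g i \<in> S" and fg: "\<And>i. i \<in> \<Delta> \<Longrightarrow> f (g i) = t i"
    by metis
  \<comment> \<open>The definition over \<open>A\<close> speaks of index sets in \<open>'a\<close>
    only, hence the version for arbitrary index types.\<close>
  obtain x where x: "x \<in> S" "\<And>i. i \<in> \<Delta> \<Longrightarrow> x \<in> PIdl\<^bsub>A\<^esub> (g i)"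
    using strongly_multiplicative_family[OF S g] by blast
  have "f x \<in> PIdl\<^bsub>B\<^esub> (t i)" if "i \<in> \<Delta>" for i
    using nonunital_ring_hom_cgenideal[OF f _ x(2)[OF that]] g carr fg[OF that] that by auto
  then show "(\<Inter>i\<in>\<Delta>. PIdl\<^bsub>B\<^esub> (t i)) \<inter> f ` S \<noteq> {}"
    using x(1) by blast
qed

theorem proposition2p11:
  fixes A :: "('a, 'm) ring_scheme" and B :: "('b, 'n) ring_scheme"
    and f :: "'a \<Rightarrow> 'b"
  assumes "cring A" and "\<one>\<^bsub>A\<^esub> \<noteq> \<zero>\<^bsub>A\<^esub>"
    and "cring B" and "\<one>\<^bsub>B\<^esub> \<noteq> \<zero>\<^bsub>B\<^esub>"
    and "f \<in> nonunital_ring_hom A B"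
  shows "(\<forall>S. strongly_multiplicative A S \<and> \<zero>\<^bsub>B\<^esub> \<notin> f ` S \<and> \<one>\<^bsub>B\<^esub> \<in> f ` S
            \<longrightarrow> strongly_multiplicative B (f ` S)) \<and>
         (\<forall>S. strongly_multiplicative A S \<and> f ` carrier A = carrier B \<and> \<zero>\<^bsub>B\<^esub> \<notin> f ` S
            \<longrightarrow> strongly_multiplicative B (f ` S))"
proof (intro conjI allI impI)
  fix S
  assume "strongly_multiplicative A S \<and> \<zero>\<^bsub>B\<^esub> \<notin> f ` S \<and> \<one>\<^bsub>B\<^esub> \<in> f ` S"
  then show "strongly_multiplicative B (f ` S)"
    using strongly_multiplicative_image[OF assms(5)] by blast
next
  fix S
  assume S: "strongly_multiplicative A S \<and> f ` carrier A = carrier B \<and> \<zero>\<^bsub>B\<^esub> \<notin> f ` S"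
  then have "f \<one>\<^bsub>A\<^esub> = \<one>\<^bsub>B\<^esub>"
    using surj_nonunital_ring_hom_one[OF assms(1,3,5)] by blast
  \<comment> \<open>Together with f(1) = 1, this yields the unit condition on f(S).\<close>
  moreover have "\<one>\<^bsub>A\<^esub> \<in> S"
    using S unfolding strongly_multiplicative_def multiplicative_set_def by blast
  ultimately have "\<one>\<^bsub>B\<^esub> \<in> f ` S"
    by force
  then show "strongly_multiplicative B (f ` S)"
    using S strongly_multiplicative_image[OF assms(5)] by blast
qed

end
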